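(* Let $1\le N<M$ be integers and let $H_0$ be a fixed self-adjoint operator on $\mathcal{H}_N=\Lambda^N\mathbb{C}^M$. The set of non-uv densities (with respect to $H_0$) is a subset of a finite union of linear subspaces of $\mathbb{R}^M$, each of dimension strictly less than $M$; and thus it has ($(M-1)$-dimensional Lebesgue) measure zero in the set of physical densities $\mathcal{P}_{M,N}$, which lies in the affine hyperplane $\{\rho\in\mathbb{R}^M\mid\sum_i\rho_i=N\}$.
   Context: Setting: $X=\{1,\dots,M\}$ is the vertex set, $e_1,\dots,e_M$ the standard basis of $\mathbb{C}^M$. $\mathcal{H}_N=\Lambda^N\mathbb{C}^M$ is the $N$-fold antisymmetric tensor product, with orthonormal basis $e_I=e_{i_1}\wedge\dots\wedge e_{i_N}$ indexed by ordered multi-indices $I=(i_1<\dots<i_N)$ in $X$. $\hat a_i^\dagger,\hat a_i$ are the fermionic creation/annihilation operators for $e_i$, so $\hat a_i^\dagger\hat a_i e_I=e_I$ if $i\in I$ and $0$ otherwise. A potential $v\in\mathbb{R}^M$ acts on $\mathcal{H}_N$ as $V=\sum_i v_i\hat a_i^\dagger\hat a_i$, and $H(v)=H_0+V$. A density matrix is a positive semidefinite operator $\Gamma$ on $\mathcal{H}_N$ of trace one; its density is $\rho_i=\mathrm{Tr}(\Gamma\hat a_i^\dagger\hat a_i)$ (for a pure normalized state $\Psi=\sum_I\Psi_Ie_I$: $\rho_i=\sum_{I\ni i}|\Psi_I|^2$). $\Gamma$ is an ensemble ground state of $H$ if $\mathrm{Tr}(\Gamma H)$ equals the smallest eigenvalue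 of $H$. Physical densities: $\mathcal{P}_{M,N}=\{\rho\in\mathbb{R}^M\mid 0\le\rho_i\le1,\ \sum_i\rho_i=N\}$. A (possibly ensemble) ground-state density $\rho$ of some $H(v)$ is called uniquely $v$-representable (uv) if its (ensemble) ground state of $H(v)$ with density $\rho$ is not an (ensemble) ground state of $H(v')$ for any $v'$ such that $v-v'$ is not a constant vector. A non-uv density is a $\rho\in\mathcal{P}_{M,N}$ that is an (ensemble) ground-state density of some $H(v)$ but is not uv; equivalently, there are $v,v'\in\mathbb{R}^M$ with $v-v'$ not constant and a density matrix $\Gamma$ with density $\rho$ that is an ensemble ground state of both $H(v)$ and $H(v')$. *)

theory Defs
  imports "HOL-Analysis.Analysis"
begin

(* The vertex set is the finite linearly ordered type 'm, so M = CARD('m).  A vector of the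
   fermionic Fock space is given by its coordinates in the orthonormal basis
   e_I = e_{i_1} \<and> ... \<and> e_{i_N}, I = {i_1 < ... < i_N}, i.e. by a function on subsets I of 'm.
   The N-fold exterior power of C^M is the sector spanned by the e_I with card I = N. *)

type_synonym 'm fock = "(complex, 'm set) vec"

definition particle_space :: "nat \<Rightarrow> ('m::{finite,linorder}) fock set" where
  "particle_space N = {\<psi>. \<forall>I. \<psi> $ I \<noteq> 0 \<longrightarrow> card I = N}"

definition basis_vec :: "('m::{finite,linorder}) set \<Rightarrow> 'm fock" where
  "basis_vec I = axis I 1"

definition cinner :: "('m::{finite,linorder}) fock \<Rightarrow> 'm fock \<Rightarrow> complex" where
  "cinner \<psi> \<phi> = (\<Sum>I\<in>UNIV. cnj (\<psi> $ I) * \<phi> $ I)"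

(* An operator on the N-particle space is a function on Fock space of which only the
   restriction to that space matters. *)

definition operator_on :: "nat \<Rightarrow> (('m::{finite,linorder}) fock \<Rightarrow> 'm fock) \<Rightarrow> bool" where
  "operator_on N A \<longleftrightarrow>
     (\<forall>\<psi>\<in>particle_space N. A \<psi> \<in> particle_space N) \<and>
     (\<forall>\<psi>\<in>particle_space N. \<forall>\<phi>\<in>particle_space N. A (\<psi> + \<phi>) = A \<psi> + A \<phi>) \<and>
     (\<forall>c. \<forall>\<psi>\<in>particle_space N. A (c *s \<psi>) = c *s A \<psi>)"

definition self_adjoint_on :: "nat \<Rightarrow> (('m::{finite,linorder}) fock \<Rightarrow> 'm fock) \<Rightarrow> bool" where
  "self_adjoint_on N A \<longleftrightarrow> operator_on N A \<and>
     (\<forall>\<psi>\<in>particle_space N. \<forall>\<phi>\<in>particle_space N. cinner \<psi> (A \<phi>) = cinner (A \<psi>) \<phi>)"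

(* The quadratic form of a self-adjoint operator is real, hence Re loses nothing. *)
definition positive_semidefinite_on ::
    "nat \<Rightarrow> (('m::{finite,linorder}) fock \<Rightarrow> 'm fock) \<Rightarrow> bool" where
  "positive_semidefinite_on N A \<longleftrightarrow> self_adjoint_on N A \<and>
     (\<forall>\<psi>\<in>particle_space N. 0 \<le> Re (cinner \<psi> (A \<psi>)))"

definition trace_on :: "nat \<Rightarrow> (('m::{finite,linorder}) fock \<Rightarrow> 'm fock) \<Rightarrow> complex" where
  "trace_on N A = (\<Sum>I | card I = N. cinner (basis_vec I) (A (basis_vec I)))"

(* Only real eigenvalues are considered; the definition is used for self-adjoint A. *)
definition eigenvalue_on ::
    "nat \<Rightarrow> (('m::{finite,linorder}) fock \<Rightarrow> 'm fock) \<Rightarrow> real \<Rightarrow> bool" where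
  "eigenvalue_on N A E \<longleftrightarrow>
     (\<exists>\<psi>\<in>particle_space N. \<psi> \<noteq> 0 \<and> A \<psi> = complex_of_real E *s \<psi>)"

definition smallest_eigenvalue_on ::
    "nat \<Rightarrow> (('m::{finite,linorder}) fock \<Rightarrow> 'm fock) \<Rightarrow> real \<Rightarrow> bool" where
  "smallest_eigenvalue_on N A E \<longleftrightarrow>
     eigenvalue_on N A E \<and> (\<forall>E'. eigenvalue_on N A E' \<longrightarrow> E \<le> E')"

(* The sign is the one of e_i \<and> e_I = (-1)^{#{j \<in> I. j < i}} e_{I \<union> {i}} for i \<notin> I. *)

definition creation :: "'m::{finite,linorder} \<Rightarrow> 'm fock \<Rightarrow> 'm fock" where
  "creation i \<psi> = (\<chi> I. if i \<in> I then (-1) ^ card {j\<in>I. j < i} * \<psi> $ (I - {i}) else 0)"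

definition annihilation :: "'m::{finite,linorder} \<Rightarrow> 'm fock \<Rightarrow> 'm fock" where
  "annihilation i \<psi> = (\<chi> I. if i \<in> I then 0 else (-1) ^ card {j\<in>I. j < i} * \<psi> $ (insert i I))"

definition number_op :: "'m::{finite,linorder} \<Rightarrow> 'm fock \<Rightarrow> 'm fock" where
  "number_op i = creation i \<circ> annihilation i"

lemma number_op_basis_vec:
  "number_op i (basis_vec I) = (if i \<in> I then basis_vec I else 0)"
proof -
  have "number_op i \<psi> $ J = (if i \<in> J then \<psi> $ J else 0)" for \<psi> :: "'a fock" and J
  proof (cases "i \<in> J")
    case True
    have "{j \<in> J. j \<noteq> i \<and> j < i} = {j \<in> J. j < i}" by auto
    with True show ?thesis
      by (simp add: number_op_def creation_def annihilation_def insert_absorb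
          flip: power_add mult.assoc)
  qed (simp add: number_op_def creation_def)
  then show ?thesis
    by (auto simp: vec_eq_iff basis_vec_def axis_def)
qed

lemma cinner_creation: "cinner \<psi> (creation i \<phi>) = cinner (annihilation i \<psi>) \<phi>"
proof -
  have "cinner \<psi> (creation i \<phi>)
      = (\<Sum>I | i \<in> I. cnj (\<psi> $ I) * ((-1) ^ card {j\<in>I. j < i} * \<phi> $ (I - {i})))"
    unfolding cinner_def by (rule sum.mono_neutral_cong_right) (auto simp: creation_def)
  also have "\<dots> = (\<Sum>I | i \<notin> I. cnj (\<psi> $ insert i I) * ((-1) ^ card {j\<in>I. j < i} * \<phi> $ I))"
  proof (rule sum.reindex_bij_witness[of _ "insert i" "\<lambda>I. I - {i}"])
    fix I assume "I \<in> {I. i \<in> I}"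
    moreover have "{j \<in> I. j \<noteq> i \<and> j < i} = {j \<in> I. j < i}" by auto
    ultimately show "cnj (\<psi> $ insert i (I - {i})) * ((-1) ^ card {j\<in>I - {i}. j < i} * \<phi> $ (I - {i}))
        = cnj (\<psi> $ I) * ((-1) ^ card {j\<in>I. j < i} * \<phi> $ (I - {i}))"
      by (simp add: insert_absorb)
  qed auto
  also have "\<dots> = cinner (annihilation i \<psi>) \<phi>"
    unfolding cinner_def by (rule sum.mono_neutral_cong_left) (auto simp: annihilation_def)
  finally show ?thesis .
qed

definition potential_op :: "(real, 'm::{finite,linorder}) vec \<Rightarrow> 'm fock \<Rightarrow> 'm fock" where
  "potential_op v \<psi> = (\<Sum>i\<in>UNIV. complex_of_real (v $ i) *s number_op i \<psi>)"

definition hamiltonian ::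
    "(('m::{finite,linorder}) fock \<Rightarrow> 'm fock) \<Rightarrow> (real, 'm) vec \<Rightarrow> 'm fock \<Rightarrow> 'm fock" where
  "hamiltonian H0 v \<psi> = H0 \<psi> + potential_op v \<psi>"

definition density_matrix :: "nat \<Rightarrow> (('m::{finite,linorder}) fock \<Rightarrow> 'm fock) \<Rightarrow> bool" where
  "density_matrix N \<Gamma> \<longleftrightarrow> positive_semidefinite_on N \<Gamma> \<and> trace_on N \<Gamma> = 1"

(* The trace below is real, number_op i being self-adjoint as well. *)
definition density :: "nat \<Rightarrow> (('m::{finite,linorder}) fock \<Rightarrow> 'm fock) \<Rightarrow> (real, 'm) vec" where
  "density N \<Gamma> = (\<chi> i. Re (trace_on N (\<Gamma> \<circ> number_op i)))"

definition ensemble_ground_state ::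
    "nat \<Rightarrow> (('m::{finite,linorder}) fock \<Rightarrow> 'm fock) \<Rightarrow> ('m fock \<Rightarrow> 'm fock) \<Rightarrow> bool" where
  "ensemble_ground_state N H \<Gamma> \<longleftrightarrow> density_matrix N \<Gamma> \<and>
     (\<exists>E. smallest_eigenvalue_on N H E \<and> trace_on N (\<Gamma> \<circ> H) = complex_of_real E)"

definition physical_densities :: "nat \<Rightarrow> (real, 'm::{finite,linorder}) vec set" where
  "physical_densities N =
     {\<rho>. (\<forall>i. 0 \<le> \<rho> $ i \<and> \<rho> $ i \<le> 1) \<and> (\<Sum>i\<in>UNIV. \<rho> $ i) = real N}"

definition ground_state_density ::
    "nat \<Rightarrow> (('m::{finite,linorder}) fock \<Rightarrow> 'm fock) \<Rightarrow> (real, 'm) vec \<Rightarrow> bool" where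
  "ground_state_density N H0 \<rho> \<longleftrightarrow>
     (\<exists>v \<Gamma>. ensemble_ground_state N (hamiltonian H0 v) \<Gamma> \<and> density N \<Gamma> = \<rho>)"

(* vec c is the constant vector (c, ..., c). *)
definition uniquely_v_representable ::
    "nat \<Rightarrow> (('m::{finite,linorder}) fock \<Rightarrow> 'm fock) \<Rightarrow> (real, 'm) vec \<Rightarrow> bool" where
  "uniquely_v_representable N H0 \<rho> \<longleftrightarrow> ground_state_density N H0 \<rho> \<and>
     (\<forall>v \<Gamma>. ensemble_ground_state N (hamiltonian H0 v) \<Gamma> \<and> density N \<Gamma> = \<rho> \<longrightarrow>
        (\<forall>v'. (\<nexists>c. v - v' = vec c) \<longrightarrow> \<not> ensemble_ground_state N (hamiltonian H0 v') \<Gamma>))"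

definition non_uv_densities ::
    "nat \<Rightarrow> (('m::{finite,linorder}) fock \<Rightarrow> 'm fock) \<Rightarrow> (real, 'm) vec set" where
  "non_uv_densities N H0 =
     {\<rho> \<in> physical_densities N. ground_state_density N H0 \<rho> \<and> \<not> uniquely_v_representable N H0 \<rho>}"

lemma mem_non_uv_densities_iff:
  "\<rho> \<in> non_uv_densities N H0 \<longleftrightarrow> \<rho> \<in> physical_densities N \<and>
     (\<exists>v v' \<Gamma>. (\<nexists>c. v - v' = vec c) \<and> density N \<Gamma> = \<rho> \<and>
        ensemble_ground_state N (hamiltonian H0 v) \<Gamma> \<and>
        ensemble_ground_state N (hamiltonian H0 v') \<Gamma>)"
  unfolding non_uv_densities_def uniquely_v_representable_def ground_state_density_def by blast

definition density_hyperplane :: "nat \<Rightarrow> (real, 'm::{finite,linorder}) vec set" where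
  "density_hyperplane N = {\<rho>. (\<Sum>i\<in>UNIV. \<rho> $ i) = real N}"

(* The Lebesgue measure of an affine subspace S is transported from a Euclidean space of the
   same dimension along an isometry onto S; surjectivity onto S forces the dimensions to agree. *)

definition isometric_chart ::
    "((real, 'k::finite) vec \<Rightarrow> (real, 'm::finite) vec) \<Rightarrow> (real, 'm) vec set \<Rightarrow> bool" where
  "isometric_chart \<phi> S \<longleftrightarrow> (\<forall>x y. dist (\<phi> x) (\<phi> y) = dist x y) \<and> range \<phi> = S"

definition chart_lebesgue ::
    "((real, 'k::finite) vec \<Rightarrow> (real, 'm::finite) vec) \<Rightarrow> (real, 'm) vec measure" where
  "chart_lebesgue \<phi> = completion (distr lborel borel \<phi>)"

lemma isometric_chart_density_hyperplane_exists:
  assumes "CARD('k::finite) + 1 = CARD('m::{finite,linorder})"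
  shows "\<exists>\<phi> :: (real, 'k) vec \<Rightarrow> (real, 'm) vec. isometric_chart \<phi> (density_hyperplane N)"
proof -
  define T where "T = {x :: (real, 'm) vec. 1 \<bullet> x = 0}"
  define a :: "(real, 'm) vec" where "a = vec (real N / real CARD('m))"
  have ip: "1 \<bullet> x = (\<Sum>i\<in>UNIV. x $ i)" for x :: "(real, 'm) vec"
    by (simp add: inner_vec_def)
  have "1 \<noteq> (0 :: (real, 'm) vec)" by (simp add: vec_eq_iff)
  then have "dim T = CARD('m) - 1"
    unfolding T_def by (subst dim_hyperplane) auto
  then have "dim (UNIV :: (real, 'k) vec set) = dim T"
    using assms by (simp add: dim_UNIV)
  moreover have "subspace T" unfolding T_def by (rule subspace_hyperplane)
  ultimately obtain f :: "(real, 'k) vec \<Rightarrow> (real, 'm) vec"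
    where f: "linear f" "f ` UNIV = T" "\<And>x. norm (f x) = norm x"
    using isometries_subspaces[of "UNIV :: (real, 'k) vec set" T] by (metis subspace_UNIV UNIV_I)
  have sum_a: "1 \<bullet> a = real N" unfolding ip by (simp add: a_def)
  have "range (\<lambda>x. a + f x) = density_hyperplane N"
  proof -
    have "range (\<lambda>x. a + f x) = (+) a ` T" using f(2) by (auto simp: image_image)
    also have "\<dots> = density_hyperplane N"
    proof (intro set_eqI iffI)
      fix y :: "(real, 'm) vec" assume "y \<in> density_hyperplane N"
      then have "y - a \<in> T"
        using sum_a by (simp add: T_def inner_diff_right density_hyperplane_def flip: ip)
      then show "y \<in> (+) a ` T" by (metis add_diff_cancel_left' diff_add_cancel add.commute image_eqI)
    qed (auto simp: T_def density_hyperplane_def inner_add_right sum_a simp flip: ip)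
    finally show ?thesis .
  qed
  moreover have "dist (a + f x) (a + f y) = dist x y" for x y
    using f(3)[of "x - y"] by (simp add: dist_norm linear_diff[OF f(1)])
  ultimately show ?thesis
    unfolding isometric_chart_def by (intro exI[of _ "\<lambda>x. a + f x"] conjI allI)
qed

end

theory Submission
  imports Defs
begin

text \<open>
  If \<open>\<Gamma>\<close> is a ground state of both \<open>H(v)\<close> and \<open>H(v')\<close>, with energies \<open>E\<close> and \<open>E'\<close>, then
  \<open>(H(v) - E) \<Gamma> = 0 = (H(v') - E') \<Gamma>\<close>. Subtracting, the diagonal operator \<open>V - V' - (E - E')\<close>
  annihilates \<open>\<Gamma>\<close>, so \<open>\<Sum>i\<in>I. v\<^sub>i - v'\<^sub>i = E - E'\<close> for every \<open>I\<close> with \<open>\<Gamma>\<^sub>I\<^sub>I \<noteq> 0\<close>. As all these \<open>I\<close>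
  have \<open>N\<close> elements, their indicator vectors are orthogonal to \<open>v - v' - (E - E') / N\<close>, which is
  nonzero because \<open>v - v'\<close> is not constant. The density \<open>\<Sum>I. \<Gamma>\<^sub>I\<^sub>I 1\<^sub>I\<close> thus lies in one of the
  finitely many proper subspaces spanned by indicator vectors. None of these contains the affine
  hyperplane of densities, since that hyperplane misses the origin.
\<close>

section \<open>Sesquilinear algebra on the particle spaces\<close>

lemma cinner_simps:
  "cinner (a + b) c = cinner a c + cinner b c"
  "cinner a (b + c) = cinner a b + cinner a c"
  "cinner (a - b) c = cinner a c - cinner b c"
  "cinner a (b - c) = cinner a b - cinner a c"
  "cinner (k *s a) c = cnj k * cinner a c"
  "cinner a (k *s c) = k * cinner a c"
  "cinner 0 c = 0"
  "cinner a 0 = 0"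
  by (simp_all add: cinner_def algebra_simps sum.distrib sum_subtractf sum_distrib_left)

lemma cinner_sum_right: "cinner a (\<Sum>x\<in>F. f x) = (\<Sum>x\<in>F. cinner a (f x))"
  by (induction F rule: infinite_finite_induct) (simp_all add: cinner_simps)

lemma cnj_cinner: "cnj (cinner a b) = cinner b a"
  by (simp add: cinner_def mult.commute)

lemma cinner_self: "cinner a a = complex_of_real ((norm a)\<^sup>2)"
  by (simp add: cinner_def norm_vec_def L2_set_def sum_nonneg complex_norm_square mult.commute
      del: of_real_power)

lemma cinner_basis_vec_left: "cinner (basis_vec I) \<psi> = \<psi> $ I"
proof -
  have "cinner (basis_vec I) \<psi> = (\<Sum>J\<in>UNIV. if J = I then \<psi> $ J else 0)"
    unfolding cinner_def basis_vec_def axis_def by (intro sum.cong) auto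
  then show ?thesis by simp
qed

lemma mem_particle_space_iff: "\<psi> \<in> particle_space N \<longleftrightarrow> (\<forall>I. card I \<noteq> N \<longrightarrow> \<psi> $ I = 0)"
  by (auto simp: particle_space_def)

lemma particle_space_simps:
  "0 \<in> particle_space N"
  "a \<in> particle_space N \<Longrightarrow> b \<in> particle_space N \<Longrightarrow> a + b \<in> particle_space N"
  "a \<in> particle_space N \<Longrightarrow> b \<in> particle_space N \<Longrightarrow> a - b \<in> particle_space N"
  "a \<in> particle_space N \<Longrightarrow> k *s a \<in> particle_space N"
  by (auto simp: mem_particle_space_iff)

lemma basis_vec_in_particle_space: "card I = N \<Longrightarrow> basis_vec I \<in> particle_space N"
  by (simp add: particle_space_def basis_vec_def axis_def)

lemma particle_space_sum:
  "(\<And>x. x \<in> F \<Longrightarrow> f x \<in> particle_space N) \<Longrightarrow> (\<Sum>x\<in>F. f x) \<in> particle_space N"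
  by (induction F rule: infinite_finite_induct) (auto simp: particle_space_simps)

lemma particle_space_expansion:
  assumes "\<psi> \<in> particle_space N"
  shows "\<psi> = (\<Sum>I | card I = N. \<psi> $ I *s basis_vec I)"
proof (unfold vec_eq_iff, rule allI)
  fix J
  have "(\<Sum>I | card I = N. \<psi> $ I *s basis_vec I) $ J
      = (\<Sum>I | card I = N. if I = J then \<psi> $ I else 0)"
    unfolding sum_component basis_vec_def axis_def by (intro sum.cong) auto
  then show "\<psi> $ J = (\<Sum>I | card I = N. \<psi> $ I *s basis_vec I) $ J"
    using assms by (auto simp: particle_space_def)
qed

section \<open>Operators on the particle spaces\<close>

lemma operator_onD:
  assumes "operator_on N A"
  shows "\<psi> \<in> particle_space N \<Longrightarrow> A \<psi> \<in> particle_space N"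
    and "\<psi> \<in> particle_space N \<Longrightarrow> \<phi> \<in> particle_space N \<Longrightarrow> A (\<psi> + \<phi>) = A \<psi> + A \<phi>"
    and "\<psi> \<in> particle_space N \<Longrightarrow> A (c *s \<psi>) = c *s A \<psi>"
    and "A 0 = 0"
    and "\<psi> \<in> particle_space N \<Longrightarrow> \<phi> \<in> particle_space N \<Longrightarrow> A (\<psi> - \<phi>) = A \<psi> - A \<phi>"
proof -
  show in_space: "\<psi> \<in> particle_space N \<Longrightarrow> A \<psi> \<in> particle_space N"
    and add: "\<psi> \<in> particle_space N \<Longrightarrow> \<phi> \<in> particle_space N \<Longrightarrow> A (\<psi> + \<phi>) = A \<psi> + A \<phi>"
    and scale: "\<psi> \<in> particle_space N \<Longrightarrow> A (c *s \<psi>) = c *s A \<psi>" for \<psi> \<phi> c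
    using assms by (auto simp: operator_on_def)
  show "A 0 = 0"
    using scale[of 0 0] by (simp add: particle_space_simps)
  assume in_N: "\<psi> \<in> particle_space N" "\<phi> \<in> particle_space N"
  then have "A (\<psi> - \<phi> + \<phi>) = A (\<psi> - \<phi>) + A \<phi>"
    by (intro add) (auto simp: particle_space_simps)
  then show "A (\<psi> - \<phi>) = A \<psi> - A \<phi>"
    by simp
qed

lemma operator_on_sum:
  assumes "operator_on N A" and "\<And>x. x \<in> F \<Longrightarrow> f x \<in> particle_space N"
  shows "A (\<Sum>x\<in>F. f x) = (\<Sum>x\<in>F. A (f x))"
  using assms(2)
  by (induction F rule: infinite_finite_induct)
    (auto simp: operator_onD[OF assms(1)] particle_space_sum)

lemma operator_on_expansion:
  assumes "operator_on N A" and "\<psi> \<in> particle_space N"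
  shows "A \<psi> = (\<Sum>I | card I = N. \<psi> $ I *s A (basis_vec I))"
proof -
  have "A \<psi> = A (\<Sum>I | card I = N. \<psi> $ I *s basis_vec I)"
    using particle_space_expansion[OF assms(2)] by simp
  also have "\<dots> = (\<Sum>I | card I = N. A (\<psi> $ I *s basis_vec I))"
    by (rule operator_on_sum[OF assms(1)])
      (simp add: particle_space_simps basis_vec_in_particle_space)
  also have "\<dots> = (\<Sum>I | card I = N. \<psi> $ I *s A (basis_vec I))"
    by (intro sum.cong) (auto simp: operator_onD[OF assms(1)] basis_vec_in_particle_space)
  finally show ?thesis .
qed

section \<open>Positive semidefinite operators and their kernels\<close>

lemma psdD:
  assumes "positive_semidefinite_on N A"
  shows "operator_on N A"
    and "\<psi> \<in> particle_space N \<Longrightarrow> \<phi> \<in> particle_space N \<Longrightarrow> cinner \<psi> (A \<phi>) = cinner (A \<psi>) \<phi>"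
    and "\<psi> \<in> particle_space N \<Longrightarrow> 0 \<le> Re (cinner \<psi> (A \<psi>))"
  using assms by (auto simp: positive_semidefinite_on_def self_adjoint_on_def)

lemma self_adjoint_quadratic_form_real:
  assumes "self_adjoint_on N A" and "\<psi> \<in> particle_space N"
  shows "cinner \<psi> (A \<psi>) = complex_of_real (Re (cinner \<psi> (A \<psi>)))"
proof -
  have "cnj (cinner \<psi> (A \<psi>)) = cinner \<psi> (A \<psi>)"
    using assms by (simp add: cnj_cinner self_adjoint_on_def)
  then show ?thesis
    by (metis Reals_cnj_iff of_real_Re)
qed

text \<open>Moving from \<open>\<psi>\<close> a distance \<open>t\<close> against
  \<open>B \<psi>\<close> changes the quadratic form by \<open>- 2 * t * n + t\<^sup>2 * c\<close>,
  where \<open>n\<close> is the squared norm of \<open>B \<psi>\<close>. A form that is already at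
  most 0 at \<open>\<psi>\<close> would become negative for small \<open>t > 0\<close> unless
  \<open>n = 0\<close>.\<close>

lemma psd_kernel:
  assumes psd: "positive_semidefinite_on N B" and \<psi>: "\<psi> \<in> particle_space N"
    and null: "Re (cinner \<psi> (B \<psi>)) \<le> 0"
  shows "B \<psi> = 0"
proof -
  note op = operator_onD[OF psdD(1)[OF psd]] and ps = particle_space_simps
  have B\<psi>: "B \<psi> \<in> particle_space N" by (rule op(1)[OF \<psi>])
  have BB\<psi>: "B (B \<psi>) \<in> particle_space N" by (rule op(1)[OF B\<psi>])
  define n where "n = (norm (B \<psi>))\<^sup>2"
  define c where "c = Re (cinner (B \<psi>) (B (B \<psi>)))"
  \<comment> \<open>The denominator \<open>c + 1\<close> is positive even for \<open>c = 0\<close>,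
    and it gives \<open>t * c \<le> n\<close>, so the quadratic term eats at most half of the linear
    one.\<close>
  define t where "t = n / (c + 1)"
  have c: "c \<ge> 0" unfolding c_def by (rule psdD(3)[OF psd B\<psi>])
  have n: "n \<ge> 0" by (simp add: n_def)
  have "B (\<psi> - of_real t *s B \<psi>) = B \<psi> - of_real t *s B (B \<psi>)"
    by (simp add: op ps \<psi> B\<psi>)
  moreover have "cinner \<psi> (B (B \<psi>)) = of_real n"
    by (simp add: psdD(2)[OF psd \<psi> B\<psi>] cinner_self n_def)
  moreover have "cinner (B \<psi>) (B \<psi>) = of_real n"
    by (simp add: cinner_self n_def)
  ultimately have "Re (cinner (\<psi> - of_real t *s B \<psi>) (B (\<psi> - of_real t *s B \<psi>)))
      = Re (cinner \<psi> (B \<psi>)) - 2 * t * n + t\<^sup>2 * c"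
    by (simp add: cinner_simps) (simp add: c_def algebra_simps power2_eq_square)
  moreover have "0 \<le> Re (cinner (\<psi> - of_real t *s B \<psi>) (B (\<psi> - of_real t *s B \<psi>)))"
    by (intro psdD(3)[OF psd] ps \<psi> B\<psi>)
  ultimately have "2 * t * n \<le> t\<^sup>2 * c" using null by linarith
  moreover have "t\<^sup>2 * c \<le> t * n"
  proof -
    have t: "t \<ge> 0" unfolding t_def using c n by simp
    have "t * c \<le> t * (c + 1)" using t by (simp add: distrib_left)
    also have "\<dots> = n" using c by (simp add: t_def)
    finally have "t * (t * c) \<le> t * n" using t by (rule mult_left_mono)
    then show ?thesis by (simp add: power2_eq_square mult.assoc)
  qed
  ultimately have "t * n \<le> 0" by linarith
  moreover have "t * n = n\<^sup>2 / (c + 1)" by (simp add: t_def power2_eq_square)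
  ultimately have "n\<^sup>2 \<le> 0" using c by (simp add: divide_le_0_iff)
  then have "n = 0" by simp
  then show ?thesis by (simp add: n_def)
qed

section \<open>Traces of products of positive operators\<close>

text \<open>One step of a Cholesky decomposition: the rank-one part of \<open>\<Gamma>\<close> along \<open>e\<close> is removed.\<close>

definition deflate :: "(('m::{finite,linorder}) fock \<Rightarrow> 'm fock) \<Rightarrow> 'm fock \<Rightarrow> 'm fock \<Rightarrow> 'm fock" where
  "deflate \<Gamma> e \<psi> = \<Gamma> \<psi> - (cinner (\<Gamma> e) \<psi> / cinner e (\<Gamma> e)) *s \<Gamma> e"

text \<open>The deflated operator is \<open>\<Gamma>\<close> applied after removing from
  \<open>\<psi>\<close> its component along \<open>e\<close>, orthogonality being taken in the form
  of \<open>\<Gamma>\<close>. Hence its form at \<open>\<psi>\<close> is the form of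
  \<open>\<Gamma>\<close> at the remainder \<open>\<xi>\<close>.\<close>

lemma psd_deflate:
  assumes psd: "positive_semidefinite_on N \<Gamma>" and e: "e \<in> particle_space N"
    and ne: "cinner e (\<Gamma> e) \<noteq> 0"
  shows "positive_semidefinite_on N (deflate \<Gamma> e)"
  unfolding positive_semidefinite_on_def self_adjoint_on_def
proof (intro conjI ballI)
  note op = operator_onD[OF psdD(1)[OF psd]] and ps = particle_space_simps
  have \<Gamma>e: "\<Gamma> e \<in> particle_space N" by (rule op(1)[OF e])
  show "operator_on N (deflate \<Gamma> e)"
    unfolding operator_on_def deflate_def
    by (auto simp: op ps \<Gamma>e cinner_simps vec_eq_iff algebra_simps add_divide_distrib)
  fix \<psi> :: "'a fock" assume \<psi>: "\<psi> \<in> particle_space N"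
  show "cinner \<psi> (deflate \<Gamma> e \<phi>) = cinner (deflate \<Gamma> e \<psi>) \<phi>" if \<phi>: "\<phi> \<in> particle_space N" for \<phi>
    by (simp add: deflate_def cinner_simps psdD(2)[OF psd \<psi> \<phi>] psdD(2)[OF psd e e]
        cnj_cinner mult.commute)
  define c where "c = cinner (\<Gamma> e) \<psi> / cinner e (\<Gamma> e)"
  define \<xi> where "\<xi> = \<psi> - c *s e"
  have \<xi>: "\<xi> \<in> particle_space N" by (simp add: \<xi>_def ps \<psi> e)
  have defl: "deflate \<Gamma> e \<psi> = \<Gamma> \<xi>"
    by (simp add: deflate_def \<xi>_def c_def op ps \<psi> e)
  \<comment> \<open>The coefficient \<open>c\<close> is chosen for this; it kills the cross term
    when the left \<open>\<xi>\<close> is expanded below.\<close>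
  have "cinner e (\<Gamma> \<xi>) = 0"
    using ne unfolding psdD(2)[OF psd e \<xi>]
    by (simp add: \<xi>_def cinner_simps c_def psdD(2)[OF psd e e])
  then have "cinner \<xi> (\<Gamma> \<xi>) = cinner \<psi> (deflate \<Gamma> e \<psi>)"
    unfolding defl by (subst \<xi>_def) (simp add: cinner_simps)
  then show "0 \<le> Re (cinner \<psi> (deflate \<Gamma> e \<psi>))"
    using psdD(3)[OF psd \<xi>] by simp
qed

text \<open>The trace sums \<open>cinner w (A e_I)\<close> times the coordinates of
  \<open>u\<close>, which is the basis expansion of \<open>A u\<close> paired with \<open>w\<close>.
  It evaluates the rank-one part that a deflation removes.\<close>

lemma trace_rank_one:
  assumes "operator_on N A" and "u \<in> particle_space N"
  shows "trace_on N (\<lambda>\<psi>. cinner w (A \<psi>) *s u) = cinner w (A u)"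
  by (subst operator_on_expansion[OF assms])
    (simp add: trace_on_def cinner_simps cinner_basis_vec_left cinner_sum_right mult.commute)

lemma trace_deflate:
  assumes "operator_on N \<Gamma>" and "operator_on N A" and "e \<in> particle_space N"
  shows "trace_on N (deflate \<Gamma> e \<circ> A)
    = trace_on N (\<Gamma> \<circ> A) - cinner (\<Gamma> e) (A (\<Gamma> e)) / cinner e (\<Gamma> e)"
proof -
  have "trace_on N (deflate \<Gamma> e \<circ> A)
      = trace_on N (\<Gamma> \<circ> A) - trace_on N (\<lambda>\<psi>. cinner (\<Gamma> e) (A \<psi>) *s \<Gamma> e) / cinner e (\<Gamma> e)"
    by (simp add: trace_on_def deflate_def cinner_simps sum_subtractf sum_divide_distrib)
  then show ?thesis
    by (simp add: trace_rank_one operator_onD assms)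
qed

lemma psd_diagonal_divide:
  assumes psd\<Gamma>: "positive_semidefinite_on N \<Gamma>" and psdA: "positive_semidefinite_on N A"
    and e: "e \<in> particle_space N"
  shows "Re (cinner (\<Gamma> e) (A (\<Gamma> e)) / cinner e (\<Gamma> e))
    = Re (cinner (\<Gamma> e) (A (\<Gamma> e))) / Re (cinner e (\<Gamma> e))"
proof -
  have "cinner e (\<Gamma> e) = complex_of_real (Re (cinner e (\<Gamma> e)))"
    using psd\<Gamma> e by (intro self_adjoint_quadratic_form_real) (auto simp: positive_semidefinite_on_def)
  then show ?thesis by (metis Re_divide_of_real)
qed

text \<open>Induction on the number of nonzero diagonal entries of \<open>\<Gamma>\<close>: each
  deflation along a basis vector clears at least one entry and splits off a rank-one part whose
  trace against \<open>A\<close> is a nonnegative multiple of a value of the form of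
  \<open>A\<close>.\<close>

lemma trace_psd_nonneg:
  assumes "positive_semidefinite_on N \<Gamma>" and psdA: "positive_semidefinite_on N A"
  shows "0 \<le> Re (trace_on N (\<Gamma> \<circ> A))"
  using assms(1)
proof (induction "card {I. card I = N \<and> \<Gamma> (basis_vec I) $ I \<noteq> 0}" arbitrary: \<Gamma> rule: less_induct)
  case (less \<Gamma>)
  note psd = less.prems
  note op = operator_onD[OF psdD(1)[OF psd]] and opA = operator_onD[OF psdD(1)[OF psdA]]
  note basis = basis_vec_in_particle_space
  show ?case
  proof (cases "\<exists>I. card I = N \<and> \<Gamma> (basis_vec I) $ I \<noteq> 0")
    \<comment> \<open>A vanishing diagonal entry forces the whole column to vanish by
      \<open>psd_kernel\<close>, so here \<open>\<Gamma>\<close> is zero on the particle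
      space.\<close>
    case False
    then have "\<Gamma> (basis_vec I) = 0" if "card I = N" for I
      using that by (intro psd_kernel[OF psd] basis) (auto simp: cinner_basis_vec_left)
    then have "\<Gamma> \<psi> = 0" if "\<psi> \<in> particle_space N" for \<psi>
      using operator_on_expansion[OF psdD(1)[OF psd] that] by simp
    then show ?thesis
      by (simp add: trace_on_def opA basis cinner_simps)
  next
    case True
    then obtain I where I: "card I = N" "\<Gamma> (basis_vec I) $ I \<noteq> 0" by blast
    let ?e = "basis_vec I" and ?\<Gamma>' = "deflate \<Gamma> (basis_vec I)"
    have e: "?e \<in> particle_space N" by (rule basis[OF I(1)])
    have ne: "cinner ?e (\<Gamma> ?e) \<noteq> 0" using I by (simp add: cinner_basis_vec_left)
    have psd': "positive_semidefinite_on N ?\<Gamma>'" by (rule psd_deflate[OF psd e ne])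
    \<comment> \<open>Zero entries stay zero and the pivot entry \<open>I\<close> becomes zero, so
      the induction measure drops strictly.\<close>
    have "?\<Gamma>' (basis_vec J) $ J = 0" if J: "card J = N" "\<Gamma> (basis_vec J) $ J = 0" for J
    proof -
      have "\<Gamma> (basis_vec J) = 0"
        using J by (intro psd_kernel[OF psd] basis) (auto simp: cinner_basis_vec_left)
      then show ?thesis
        by (simp add: deflate_def cinner_simps flip: psdD(2)[OF psd e basis[OF J(1)]])
    qed
    moreover have "?\<Gamma>' ?e $ I = 0"
      using ne by (simp add: deflate_def flip: psdD(2)[OF psd e e])
    ultimately have "{J. card J = N \<and> ?\<Gamma>' (basis_vec J) $ J \<noteq> 0}
        \<subset> {J. card J = N \<and> \<Gamma> (basis_vec J) $ J \<noteq> 0}"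
      using I by blast
    then have "0 \<le> Re (trace_on N (?\<Gamma>' \<circ> A))"
      by (intro less.hyps psd' psubset_card_mono) simp
    moreover have "0 \<le> Re (cinner (\<Gamma> ?e) (A (\<Gamma> ?e))) / Re (cinner ?e (\<Gamma> ?e))"
      by (intro divide_nonneg_nonneg psdD(3)[OF psd e] psdD(3)[OF psdA] op e)
    ultimately show ?thesis
      by (simp add: trace_deflate psdD(1)[OF psd] psdD(1)[OF psdA] e
          psd_diagonal_divide[OF psd psdA e])
  qed
qed

text \<open>Deflating along \<open>e\<close> lowers the trace by a multiple of the form of
  \<open>A\<close> at \<open>\<Gamma> e\<close>. The trace starts at 0 and stays nonnegative, so
  that form is at most 0 there, and \<open>psd_kernel\<close> applies to \<open>A\<close>.\<close>

lemma trace_psd_eq_0_imp: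
  assumes psd: "positive_semidefinite_on N \<Gamma>" and psdA: "positive_semidefinite_on N A"
    and tr: "trace_on N (\<Gamma> \<circ> A) = 0" and e: "e \<in> particle_space N"
  shows "A (\<Gamma> e) = 0"
proof (cases "cinner e (\<Gamma> e) = 0")
  \<comment> \<open>Deflation would divide by zero here, but \<open>\<Gamma> e\<close> itself
    vanishes.\<close>
  case True
  then have "\<Gamma> e = 0" by (intro psd_kernel[OF psd e]) simp
  then show ?thesis by (simp add: operator_onD[OF psdD(1)[OF psdA]])
next
  case False
  have "cinner e (\<Gamma> e) = complex_of_real (Re (cinner e (\<Gamma> e)))"
    using psd e by (intro self_adjoint_quadratic_form_real) (auto simp: positive_semidefinite_on_def)
  with False have "Re (cinner e (\<Gamma> e)) \<noteq> 0" by (metis of_real_0)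
  then have pos: "0 < Re (cinner e (\<Gamma> e))" using psdD(3)[OF psd e] by simp
  have "0 \<le> Re (trace_on N (deflate \<Gamma> e \<circ> A))"
    by (intro trace_psd_nonneg psd_deflate psd psdA e False)
  then have "Re (cinner (\<Gamma> e) (A (\<Gamma> e))) / Re (cinner e (\<Gamma> e)) \<le> 0"
    by (simp add: trace_deflate psdD(1)[OF psd] psdD(1)[OF psdA] e tr
        psd_diagonal_divide[OF psd psdA e])
  with pos have "Re (cinner (\<Gamma> e) (A (\<Gamma> e))) \<le> 0"
    by (simp add: divide_le_0_iff)
  then show ?thesis
    by (intro psd_kernel[OF psdA] operator_onD(1)[OF psdD(1)[OF psd] e])
qed

section \<open>Ground states\<close>

lemma self_adjoint_shift:
  assumes "self_adjoint_on N H"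
  shows "self_adjoint_on N (\<lambda>\<psi>. H \<psi> - complex_of_real E *s \<psi>)"
proof -
  have "operator_on N H" using assms by (simp add: self_adjoint_on_def)
  note op = operator_onD[OF this]
  show ?thesis
    using assms unfolding self_adjoint_on_def operator_on_def
    by (auto simp: op particle_space_simps cinner_simps algebra_simps vec_eq_iff)
qed

section \<open>The variational principle for the smallest eigenvalue\<close>

lemma psd_shift_iff:
  assumes "self_adjoint_on N H"
  shows "positive_semidefinite_on N (\<lambda>\<psi>. H \<psi> - complex_of_real E *s \<psi>)
    \<longleftrightarrow> (\<forall>\<psi>\<in>particle_space N. E * (norm \<psi>)\<^sup>2 \<le> Re (cinner \<psi> (H \<psi>)))"
  using self_adjoint_shift[OF assms]
  by (simp add: positive_semidefinite_on_def cinner_simps cinner_self)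

lemma compact_particle_sphere: "compact (particle_space N \<inter> sphere 0 1)"
proof (rule closed_Int_compact)
  have "particle_space N = (\<Inter>I\<in>{I. card I \<noteq> N}. {\<psi>. \<psi> $ I = 0})"
    by (auto simp: particle_space_def)
  also have "closed \<dots>"
    by (intro closed_INT ballI closed_Collect_eq continuous_intros)
  finally show "closed (particle_space N)" .
qed simp

text \<open>The quadratic form of \<open>H\<close> attains a minimum \<open>\<mu>\<close> on the
  compact unit sphere. The form of \<open>H - \<mu>\<close> is nonnegative and vanishes at the
  minimiser, which is therefore an eigenvector by \<open>psd_kernel\<close>; so
  \<open>E \<le> \<mu>\<close>, and the bound by \<open>\<mu>\<close> gives the bound by
  \<open>E\<close>.\<close>

lemma smallest_eigenvalue_psd:
  fixes H :: "('m::{finite,linorder}) fock \<Rightarrow> 'm fock"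
  assumes sa: "self_adjoint_on N H" and E: "smallest_eigenvalue_on N H E"
  shows "positive_semidefinite_on N (\<lambda>\<psi>. H \<psi> - complex_of_real E *s \<psi>)"
proof -
  note ps = particle_space_simps
  have opH: "operator_on N H" using sa by (simp add: self_adjoint_on_def)
  note op = operator_onD[OF opH]
  let ?S = "particle_space N \<inter> sphere 0 1 :: 'm fock set" and ?f = "\<lambda>\<psi>. Re (cinner \<psi> (H \<psi>))"
  have normalise: "(complex_of_real (inverse (norm \<psi>)) *s \<psi>) \<in> ?S"
    if "\<psi> \<in> particle_space N" "\<psi> \<noteq> 0" for \<psi> :: "'m fock"
  proof -
    have eq: "complex_of_real (inverse (norm \<psi>)) *s \<psi> = inverse (norm \<psi>) *\<^sub>R \<psi>"
      by (intro vec_eq_iff[THEN iffD2] allI)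
        (simp only: vector_smult_component vector_scaleR_component scaleR_conv_of_real[where 'a = complex])
    have "norm (inverse (norm \<psi>) *\<^sub>R \<psi>) = 1" using that(2) by simp
    then have "complex_of_real (inverse (norm \<psi>)) *s \<psi> \<in> sphere 0 1"
      unfolding eq mem_sphere_0 .
    then show ?thesis by (intro IntI ps that)
  qed
  \<comment> \<open>\<open>H\<close> is constrained only on the particle space, so continuity is
    proved for the basis expansion, which is explicit in the coordinates and agrees with
    \<open>?f\<close> on the sphere.\<close>
  have cont: "continuous_on ?S ?f"
  proof (rule continuous_on_eq)
    show "continuous_on ?S (\<lambda>\<psi>. Re (cinner \<psi> (\<Sum>I | card I = N. \<psi> $ I *s H (basis_vec I))))"
      unfolding cinner_def sum_component vector_smult_component by (intro continuous_intros)
    fix \<psi> assume "\<psi> \<in> ?S"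
    then show "Re (cinner \<psi> (\<Sum>I | card I = N. \<psi> $ I *s H (basis_vec I))) = ?f \<psi>"
      using operator_on_expansion[OF opH, of \<psi>] by simp
  qed
  \<comment> \<open>Any eigenvector for \<open>E\<close> shows that the sphere is nonempty.\<close>
  obtain \<phi> :: "'m fock" where \<phi>: "\<phi> \<in> particle_space N" "\<phi> \<noteq> 0"
    using E unfolding smallest_eigenvalue_on_def eigenvalue_on_def by blast
  have ne: "?S \<noteq> {}"
    using normalise[OF \<phi>] by blast
  obtain \<psi>0 where \<psi>0: "\<psi>0 \<in> ?S" and min: "\<And>\<psi>. \<psi> \<in> ?S \<Longrightarrow> ?f \<psi>0 \<le> ?f \<psi>"
    using continuous_attains_inf[OF compact_particle_sphere ne cont] by auto
  define \<mu> where "\<mu> = ?f \<psi>0"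
  have bound: "\<mu> * (norm \<psi>)\<^sup>2 \<le> ?f \<psi>" if \<psi>: "\<psi> \<in> particle_space N" for \<psi>
  proof (cases "\<psi> = 0")
    case False
    let ?c = "inverse (norm \<psi>)"
    have "\<mu> \<le> ?f (complex_of_real ?c *s \<psi>)"
      unfolding \<mu>_def by (intro min normalise \<psi> False)
    also have "\<dots> = ?c\<^sup>2 * ?f \<psi>"
      by (simp only: op(3)[OF \<psi>] cinner_simps complex_cnj_complex_of_real)
        (simp add: power2_eq_square mult.assoc del: of_real_inverse)
    finally show ?thesis
      using False by (simp add: power_inverse field_simps)
  qed (simp add: cinner_simps)
  let ?B = "\<lambda>\<psi>. H \<psi> - complex_of_real \<mu> *s \<psi>"
  have psd: "positive_semidefinite_on N ?B"
    using bound by (simp add: psd_shift_iff[OF sa])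
  have "?B \<psi>0 = 0"
    using \<psi>0 by (intro psd_kernel[OF psd]) (auto simp: cinner_simps cinner_self \<mu>_def)
  then have "H \<psi>0 = complex_of_real \<mu> *s \<psi>0" by simp
  moreover have "\<psi>0 \<in> particle_space N" "\<psi>0 \<noteq> 0" using \<psi>0 by auto
  ultimately have "eigenvalue_on N H \<mu>" unfolding eigenvalue_on_def by blast
  then have "E \<le> \<mu>"
    using E by (simp add: smallest_eigenvalue_on_def)
  then have "E * (norm \<psi>)\<^sup>2 \<le> ?f \<psi>" if "\<psi> \<in> particle_space N" for \<psi>
    using bound[OF that] mult_right_mono[of E \<mu> "(norm \<psi>)\<^sup>2"] by simp
  then show ?thesis
    by (simp add: psd_shift_iff[OF sa])
qed

section \<open>Hamiltonians in the occupation basis, and their ground states\<close>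

lemma number_op_component: "number_op i \<psi> $ I = (if i \<in> I then \<psi> $ I else 0)"
proof (cases "i \<in> I")
  case True
  \<comment> \<open>Removing \<open>i\<close> leaves the elements below \<open>i\<close> unchanged,
    so the signs of creation and annihilation agree and multiply to 1.\<close>
  have "{j \<in> I. j \<noteq> i \<and> j < i} = {j \<in> I. j < i}" by auto
  with True show ?thesis
    by (simp add: number_op_def creation_def annihilation_def insert_absorb
        flip: power_add mult.assoc)
qed (simp add: number_op_def creation_def)

lemma potential_op_component:
  "potential_op v \<psi> $ I = complex_of_real (\<Sum>i\<in>I. v $ i) * \<psi> $ I"
proof -
  have "potential_op v \<psi> $ I = (\<Sum>i\<in>UNIV. if i \<in> I then complex_of_real (v $ i) * \<psi> $ I else 0)"
    unfolding potential_op_def sum_component by (intro sum.cong) (auto simp: number_op_component)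
  also have "\<dots> = (\<Sum>i\<in>I. complex_of_real (v $ i) * \<psi> $ I)"
    by (simp flip: sum.inter_restrict)
  finally show ?thesis by (simp add: sum_distrib_right)
qed

lemma self_adjoint_hamiltonian:
  assumes "self_adjoint_on N H0"
  shows "self_adjoint_on N (hamiltonian H0 v)"
proof -
  have "operator_on N H0" using assms by (simp add: self_adjoint_on_def)
  note op = operator_onD[OF this]
  have in_space: "potential_op v \<psi> \<in> particle_space N" if "\<psi> \<in> particle_space N" for \<psi>
    using that by (auto simp: particle_space_def potential_op_component)
  have add: "potential_op v (\<psi> + \<phi>) = potential_op v \<psi> + potential_op v \<phi>" for \<psi> \<phi>
    by (simp add: vec_eq_iff potential_op_component algebra_simps)
  have scale: "potential_op v (c *s \<psi>) = c *s potential_op v \<psi>" for c \<psi>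
    by (simp add: vec_eq_iff potential_op_component algebra_simps)
  have sym: "cinner \<psi> (potential_op v \<phi>) = cinner (potential_op v \<psi>) \<phi>" for \<psi> \<phi>
    by (simp add: cinner_def potential_op_component algebra_simps)
  show ?thesis
    using assms unfolding self_adjoint_on_def operator_on_def hamiltonian_def
    by (auto simp: op in_space add scale sym particle_space_simps cinner_simps algebra_simps
        vector_add_ldistrib)
qed

text \<open>As \<open>\<Gamma>\<close> has trace one, the energy condition says that
  \<open>H - E\<close>, which is positive semidefinite, has trace 0 against \<open>\<Gamma>\<close>;
  by \<open>trace_psd_eq_0_imp\<close> it then annihilates the range of
  \<open>\<Gamma>\<close>.\<close>

lemma ensemble_ground_state_eq:
  assumes sa: "self_adjoint_on N H" and gs: "ensemble_ground_state N H \<Gamma>"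
  obtains E where "\<And>\<psi>. \<psi> \<in> particle_space N \<Longrightarrow> H (\<Gamma> \<psi>) = complex_of_real E *s \<Gamma> \<psi>"
proof -
  obtain E where E: "smallest_eigenvalue_on N H E" and tr: "trace_on N (\<Gamma> \<circ> H) = complex_of_real E"
    using gs by (auto simp: ensemble_ground_state_def)
  have psd: "positive_semidefinite_on N \<Gamma>" and tr1: "trace_on N \<Gamma> = 1"
    using gs by (auto simp: ensemble_ground_state_def density_matrix_def)
  note op = operator_onD[OF psdD(1)[OF psd]]
  have opH: "operator_on N H" using sa by (simp add: self_adjoint_on_def)
  let ?A = "\<lambda>\<psi>. H \<psi> - complex_of_real E *s \<psi>"
  have "trace_on N (\<Gamma> \<circ> ?A) = trace_on N (\<Gamma> \<circ> H) - complex_of_real E * trace_on N \<Gamma>"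
    by (simp add: trace_on_def op operator_onD[OF opH] basis_vec_in_particle_space
        particle_space_simps cinner_simps sum_subtractf sum_distrib_left)
  then have "trace_on N (\<Gamma> \<circ> ?A) = 0" by (simp add: tr tr1)
  then have "?A (\<Gamma> \<psi>) = 0" if "\<psi> \<in> particle_space N" for \<psi>
    using trace_psd_eq_0_imp[OF psd smallest_eigenvalue_psd[OF sa E] _ that] by simp
  then show ?thesis by (intro that[of E]) simp
qed

section \<open>Non-uniquely representable densities\<close>

text \<open>For \<open>card I = N\<close> this is the density of the pure state
  \<open>basis_vec I\<close>.\<close>

definition indicator_vec :: "'m set \<Rightarrow> (real, 'm::finite) vec" where
  "indicator_vec I = (\<chi> i. if i \<in> I then 1 else 0)"

lemma inner_indicator_vec: "u \<bullet> indicator_vec I = (\<Sum>i\<in>I. u $ i)"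
proof -
  have "u \<bullet> indicator_vec I = (\<Sum>i\<in>UNIV. if i \<in> I then u $ i else 0)"
    unfolding inner_vec_def indicator_vec_def by (intro sum.cong) auto
  then show ?thesis by (simp flip: sum.inter_restrict)
qed

lemma density_eq_sum_indicator_vec:
  assumes "operator_on N \<Gamma>"
  shows "density N \<Gamma> = (\<Sum>I | card I = N. Re (\<Gamma> (basis_vec I) $ I) *\<^sub>R indicator_vec I)"
  unfolding density_def trace_on_def indicator_vec_def
  by (auto simp: vec_eq_iff number_op_basis_vec cinner_basis_vec_left operator_onD[OF assms]
      intro!: sum.cong)

text \<open>The subspace is determined by a family \<open>F\<close> of subsets alone, so only
  finitely many can occur however \<open>v\<close>, \<open>v'\<close> and \<open>\<Gamma>\<close>
  vary.\<close>

lemma non_uv_density_in_proper_span: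
  fixes H0 :: "('m::{finite,linorder}) fock \<Rightarrow> 'm fock"
  assumes N: "1 \<le> N" and sa: "self_adjoint_on N H0" and \<rho>: "\<rho> \<in> non_uv_densities N H0"
  shows "\<exists>F :: 'm set set. dim (span (indicator_vec ` F)) < CARD('m) \<and> \<rho> \<in> span (indicator_vec ` F)"
proof -
  obtain v v' :: "(real, 'm) vec" and \<Gamma> where nonconst: "\<nexists>c. v - v' = vec c" and dens: "density N \<Gamma> = \<rho>"
    and gs: "ensemble_ground_state N (hamiltonian H0 v) \<Gamma>"
    and gs': "ensemble_ground_state N (hamiltonian H0 v') \<Gamma>"
    using \<rho> by (auto simp: mem_non_uv_densities_iff)
  obtain E where E: "\<And>\<psi>. \<psi> \<in> particle_space N \<Longrightarrow> hamiltonian H0 v (\<Gamma> \<psi>) = complex_of_real E *s \<Gamma> \<psi>"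
    using ensemble_ground_state_eq[OF self_adjoint_hamiltonian[OF sa] gs] by blast
  obtain E' where E': "\<And>\<psi>. \<psi> \<in> particle_space N \<Longrightarrow> hamiltonian H0 v' (\<Gamma> \<psi>) = complex_of_real E' *s \<Gamma> \<psi>"
    using ensemble_ground_state_eq[OF self_adjoint_hamiltonian[OF sa] gs'] by blast
  have op\<Gamma>: "operator_on N \<Gamma>"
    using gs by (auto simp: ensemble_ground_state_def density_matrix_def intro: psdD(1))
  \<comment> \<open>Summed over \<open>N\<close> sites, the constant shift contributes exactly
    \<open>E - E'\<close>; it turns the affine condition on \<open>v - v'\<close> into orthogonality
    to \<open>u\<close>.\<close>
  define u where "u = v - v' - vec ((E - E') / real N)"
  define F where "F = {I. card I = N \<and> \<Gamma> (basis_vec I) $ I \<noteq> 0}"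
  have "u \<noteq> 0" using nonconst by (auto simp: u_def)
  have orth: "u \<bullet> indicator_vec I = 0" if "I \<in> F" for I
  proof -
    let ?g = "\<Gamma> (basis_vec I)"
    have I: "card I = N" "?g $ I \<noteq> 0" using that by (auto simp: F_def)
    \<comment> \<open>Both eigenvalue equations are read at the diagonal coordinate \<open>I\<close>
      of the column \<open>?g\<close>: the \<open>H0\<close> terms cancel on subtraction and the
      nonzero entry can be divided out.\<close>
    have "H0 ?g $ I + complex_of_real (\<Sum>i\<in>I. v $ i) * ?g $ I = complex_of_real E * ?g $ I"
      "H0 ?g $ I + complex_of_real (\<Sum>i\<in>I. v' $ i) * ?g $ I = complex_of_real E' * ?g $ I"
      using E[OF basis_vec_in_particle_space[OF I(1)]] E'[OF basis_vec_in_particle_space[OF I(1)]]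
      by (simp_all add: hamiltonian_def vec_eq_iff potential_op_component)
    then have "complex_of_real ((\<Sum>i\<in>I. v $ i) - (\<Sum>i\<in>I. v' $ i)) * ?g $ I
        = complex_of_real (E - E') * ?g $ I"
      by (simp only: of_real_diff left_diff_distrib) (metis add_diff_cancel_left)
    then have "(\<Sum>i\<in>I. v $ i) - (\<Sum>i\<in>I. v' $ i) = E - E'"
      using I(2) by (metis mult_cancel_right of_real_eq_iff)
    then show ?thesis
      using N I(1) by (simp add: inner_indicator_vec u_def sum_subtractf)
  qed
  have "span (indicator_vec ` F) \<subseteq> {x. u \<bullet> x = 0}"
    by (rule span_minimal) (auto simp: orth subspace_hyperplane)
  then have "dim (span (indicator_vec ` F)) \<le> dim {x. u \<bullet> x = 0}"
    by (rule dim_subset)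
  also have "\<dots> < CARD('m)"
    using dim_hyperplane[OF \<open>u \<noteq> 0\<close>] by simp
  finally have "dim (span (indicator_vec ` F)) < CARD('m)" .
  moreover have "\<rho> = (\<Sum>I\<in>F. Re (\<Gamma> (basis_vec I) $ I) *\<^sub>R indicator_vec I)"
    unfolding dens[symmetric] density_eq_sum_indicator_vec[OF op\<Gamma>]
    by (rule sum.mono_neutral_right) (auto simp: F_def)
  then have "\<rho> \<in> span (indicator_vec ` F)"
    by (simp add: span_sum span_mul span_base)
  ultimately show ?thesis by blast
qed

section \<open>Null sets in the hyperplane of densities\<close>

text \<open>After translation the map fixes 0, so it preserves norms as well as distances, hence
  inner products by polarisation. The defects of additivity and homogeneity then have squared norm
  0.\<close>

lemma isometry_affine:
  fixes \<phi> :: "'a::real_inner \<Rightarrow> 'b::real_inner"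
  assumes "\<And>x y. dist (\<phi> x) (\<phi> y) = dist x y"
  shows "linear (\<lambda>x. \<phi> x - \<phi> 0)"
proof -
  define f where "f = (\<lambda>x. \<phi> x - \<phi> 0)"
  have dist_f: "norm (f x - f y) = norm (x - y)" for x y
    using assms[of x y] by (simp add: f_def dist_norm)
  have norm_f: "norm (f x) = norm x" for x
    using assms[of x 0] by (simp add: f_def dist_norm)
  have inner_f: "f x \<bullet> f y = x \<bullet> y" for x y
    by (simp only: dot_norm_neg dist_f norm_f)
  have "linear f"
  proof (rule linearI)
    fix x y :: 'a and c :: real
    have "(f (x + y) - (f x + f y)) \<bullet> (f (x + y) - (f x + f y)) = 0"
      by (simp only: inner_diff_left inner_diff_right inner_add_left inner_add_right inner_f)
    then show "f (x + y) = f x + f y" by simp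
    have "(f (c *\<^sub>R x) - c *\<^sub>R f x) \<bullet> (f (c *\<^sub>R x) - c *\<^sub>R f x) = 0"
      by (simp only: inner_diff_left inner_diff_right inner_scaleR_left inner_scaleR_right inner_f) simp
    then show "f (c *\<^sub>R x) = c *\<^sub>R f x" by simp
  qed
  then show ?thesis by (simp only: f_def)
qed

text \<open>\<open>S\<close> lies in a hyperplane through the origin, whose preimage under the
  affine chart is the solution set of one linear equation. That set is negligible unless the
  equation is trivial, which would put all of \<open>density_hyperplane N\<close> inside the
  hyperplane.\<close>

lemma null_sets_chart_lebesgue:
  fixes \<phi> :: "(real, 'k::finite) vec \<Rightarrow> (real, 'm::{finite,linorder}) vec"
  assumes N: "1 \<le> N" and chart: "isometric_chart \<phi> (density_hyperplane N)"
    and S: "subspace S" "dim S < CARD('m)"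
  shows "S \<in> null_sets (chart_lebesgue \<phi>)"
proof -
  have iso: "dist (\<phi> x) (\<phi> y) = dist x y" and range: "range \<phi> = density_hyperplane N" for x y
    using chart by (auto simp: isometric_chart_def)
  define f where "f x = \<phi> x - \<phi> 0" for x
  have lin: "linear f" unfolding f_def by (rule isometry_affine[OF iso])
  obtain a :: "(real, 'm) vec" where a: "a \<noteq> 0" "S \<subseteq> {x. a \<bullet> x = 0}"
    using lowdim_subset_hyperplane[of S] S by (auto simp: span_eq_iff[THEN iffD2])
  define b where "b = adjoint f a"
  have preimage: "\<phi> -` {x. a \<bullet> x = 0} = {y. b \<bullet> y = - (a \<bullet> \<phi> 0)}"
    by (simp add: vimage_def b_def adjoint_clauses[OF lin]) (simp add: f_def inner_diff_right)
  have "b \<noteq> 0 \<or> - (a \<bullet> \<phi> 0) \<noteq> 0"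
  proof (rule ccontr)
    assume "\<not> (b \<noteq> 0 \<or> - (a \<bullet> \<phi> 0) \<noteq> 0)"
    then have "\<phi> -` {x. a \<bullet> x = 0} = UNIV" using preimage by simp
    then have "density_hyperplane N \<subseteq> {x. a \<bullet> x = 0}"
      using image_vimage_subset[of \<phi> "{x. a \<bullet> x = 0}"] by (simp only: range)
    \<comment> \<open>These points span the whole space because \<open>N\<close> is nonzero, so a
      vector orthogonal to all of them is 0.\<close>
    moreover have "axis i (real N) \<in> density_hyperplane N" for i :: 'm
      by (simp add: density_hyperplane_def axis_def)
    ultimately have "a $ i = 0" for i
      using N by (force simp: inner_axis)
    then show False using a(1) by (simp add: vec_eq_iff)
  qed
  then have "negligible (\<phi> -` {x. a \<bullet> x = 0})"
    unfolding preimage by (rule negligible_hyperplane)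
  have cont: "continuous_on UNIV \<phi>"
    unfolding continuous_on_iff using iso by metis
  then have meas: "\<phi> \<in> borel_measurable borel"
    by (rule borel_measurable_continuous_onI)
  have closed: "{x. a \<bullet> x = 0} \<in> sets borel"
    by (intro borel_closed closed_hyperplane)
  have "\<phi> -` {x. a \<bullet> x = 0} \<in> sets borel"
    using measurable_sets[OF meas closed] by simp
  then have "emeasure lborel (\<phi> -` {x. a \<bullet> x = 0}) = 0"
    using \<open>negligible (\<phi> -` {x. a \<bullet> x = 0})\<close>
    by (simp add: negligible_iff_null_sets null_sets_def)
  then have "{x. a \<bullet> x = 0} \<in> null_sets (distr lborel borel \<phi>)"
    using meas closed by (simp add: null_sets_def emeasure_distr)
  \<comment> \<open>\<open>S\<close> is a subset of a Borel null set, hence null for the completed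
    measure.\<close>
  then show ?thesis
    unfolding chart_lebesgue_def using a(2) null_sets_completion_iff2 by blast
qed

section \<open>The finite cover by subspaces and the resulting null set\<close>

theorem theorem11:
  fixes H0 :: "('m::{finite,linorder}) fock \<Rightarrow> 'm fock" and N :: nat
  assumes "1 \<le> N" and "N < CARD('m)"
    and "self_adjoint_on N H0"
  shows "(\<exists>\<S> :: (real, 'm) vec set set. finite \<S> \<and> (\<forall>S\<in>\<S>. subspace S \<and> dim S < CARD('m)) \<and>
            non_uv_densities N H0 \<subseteq> \<Union>\<S>)
       \<and> physical_densities N \<subseteq> (density_hyperplane N :: (real, 'm) vec set)
       \<and> (\<forall>\<phi> :: real ^ 'k \<Rightarrow> (real, 'm) vec. isometric_chart \<phi> (density_hyperplane N) \<longrightarrow>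
            non_uv_densities N H0 \<in> null_sets (chart_lebesgue \<phi>))"
proof -
  \<comment> \<open>Finite as a subset of the image of the finite type \<open>'m set set\<close>;
    the filter keeps the proper subspaces.\<close>
  define \<S> :: "(real, 'm) vec set set"
    where "\<S> = {S \<in> (\<lambda>F. span (indicator_vec ` F)) ` UNIV. dim S < CARD('m)}"
  have fin: "finite \<S>" unfolding \<S>_def by simp
  have sub: "subspace S" "dim S < CARD('m)" if "S \<in> \<S>" for S
    using that by (auto simp: \<S>_def)
  have cover: "non_uv_densities N H0 \<subseteq> \<Union>\<S>"
  proof
    fix \<rho> assume "\<rho> \<in> non_uv_densities N H0"
    then obtain F :: "'m set set" where "dim (span (indicator_vec ` F)) < CARD('m)" "\<rho> \<in> span (indicator_vec ` F)"
      using non_uv_density_in_proper_span[OF assms(1,3)] by blast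
    then show "\<rho> \<in> \<Union>\<S>"
      unfolding \<S>_def by blast
  qed
  have "non_uv_densities N H0 \<in> null_sets (chart_lebesgue \<phi>)"
    if chart: "isometric_chart \<phi> (density_hyperplane N)" for \<phi> :: "real ^ 'k \<Rightarrow> (real, 'm) vec"
  proof -
    have "(\<Union>S\<in>\<S>. S) \<in> null_sets (chart_lebesgue \<phi>)"
      by (intro null_sets_UN' countable_finite fin null_sets_chart_lebesgue[OF assms(1) chart] sub)
    then have "\<Union>\<S> \<in> null_sets (chart_lebesgue \<phi>)" by simp
    \<comment> \<open>Measurability of the set of non-uv densities comes from the completeness of
      \<open>chart_lebesgue\<close>.\<close>
    then show ?thesis
      using cover unfolding chart_lebesgue_def by (rule null_sets_completion_subset[rotated])
  qed
  moreover have "physical_densities N \<subseteq> (density_hyperplane N :: (real, 'm) vec set)"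
    by (auto simp: physical_densities_def density_hyperplane_def)
  ultimately show ?thesis
    by (intro conjI exI[of _ \<S>] ballI allI impI fin sub cover)
qed

end
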